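(* For every integer $k\ge 0$, $|I_k(132,213)|$ is the number of Gorenstein partitions of $k$.
   Context: A permutation of length $n$ is a word $\pi=\pi_1\cdots\pi_n$ containing each of $1,\dots,n$ exactly once. The sum of permutations $\rho=\rho_1\cdots\rho_n$ and $\tau=\tau_1\cdots\tau_m$ is the permutation $\rho\oplus\tau=\rho_1\cdots\rho_n(n+\tau_1)\cdots(n+\tau_m)$ of length $n+m$. A permutation is decomposable if it equals $\rho\oplus\tau$ for some non-empty permutations $\rho,\tau$; a non-empty permutation that is not decomposable is indecomposable. An inversion of $\pi$ is a pair $(i,j)$ with $i<j$ and $\pi_i>\pi_j$. A permutation $\pi$ contains a permutation (pattern) $\tau=\tau_1\cdots\tau_m$ if there are indices $i_1<\dots<i_m$ such that $\pi_{i_1},\dots,\pi_{i_m}$ is order-isomorphic to $\tau_1,\dots,\tau_m$; otherwise $\pi$ avoids $\tau$. $I_k(\tau_1,\dots,\tau_r)$ denotes the (finite) set of all indecomposable permutations, of any length, with exactly $k$ inversions that avoid all of $\tau_1,\dots,\tau_r$. A partition $\rho=(\rho_1\ge\dots\ge\rho_r\ge 1)$ is regarded as the order ideal $\{(a,i): 1\le i\le r,\ 1\le a\le\rho_i\}$ of $\{1,2,\dots\}\times\{1,2,\dots\}$ under the product order. The partition is Gorenstein if all maximal chains (with respect to inclusion) of this finite poset have the same size. The empty partition of $0$ is Gorenstein. *)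

theory Defs
  imports "HOL-Combinatorics.Multiset_Permutations" "HOL-Library.Product_Order"
begin

section \<open>Permutations as words\<close>

text \<open>
  A permutation of length n is a list in which each of 1, ..., n occurs exactly once.
  Values start at 1, whereas positions, accessed with \<open>!\<close>, start at 0.
\<close>

definition is_perm :: "nat list \<Rightarrow> bool" where
  "is_perm p \<longleftrightarrow> p \<in> permutations_of_set {1..length p}"

definition perm_sum :: "nat list \<Rightarrow> nat list \<Rightarrow> nat list" where
  "perm_sum r t = r @ map (\<lambda>x. length r + x) t"

definition decomposable :: "nat list \<Rightarrow> bool" where
  "decomposable p \<longleftrightarrow>
     (\<exists>r t. is_perm r \<and> is_perm t \<and> r \<noteq> [] \<and> t \<noteq> [] \<and> p = perm_sum r t)"

definition indecomposable :: "nat list \<Rightarrow> bool" where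
  "indecomposable p \<longleftrightarrow> is_perm p \<and> p \<noteq> [] \<and> \<not> decomposable p"

definition inversions :: "nat list \<Rightarrow> (nat \<times> nat) set" where
  "inversions p = {(i, j). i < j \<and> j < length p \<and> p ! i > p ! j}"

text \<open>
  \<open>f\<close> lists the positions of \<open>p\<close>, in increasing order, at which the pattern \<open>t\<close> occurs.
\<close>

definition contains :: "nat list \<Rightarrow> nat list \<Rightarrow> bool" where
  "contains p t \<longleftrightarrow>
     (\<exists>f. strict_mono_on {..<length t} f \<and> f ` {..<length t} \<subseteq> {..<length p} \<and>
          (\<forall>a<length t. \<forall>b<length t. p ! f a < p ! f b \<longleftrightarrow> t ! a < t ! b))"

abbreviation avoids :: "nat list \<Rightarrow> nat list \<Rightarrow> bool" where
  "avoids p t \<equiv> \<not> contains p t"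

definition indec_avoiders :: "nat \<Rightarrow> nat list set \<Rightarrow> nat list set" where
  "indec_avoiders k T =
     {p. indecomposable p \<and> card (inversions p) = k \<and> (\<forall>t\<in>T. avoids p t)}"

section \<open>Gorenstein partitions\<close>

definition is_partition :: "nat list \<Rightarrow> nat \<Rightarrow> bool" where
  "is_partition r k \<longleftrightarrow> sorted_wrt (\<ge>) r \<and> (\<forall>x\<in>set r. x \<ge> 1) \<and> sum_list r = k"

definition order_ideal :: "nat list \<Rightarrow> (nat \<times> nat) set" where
  "order_ideal r = {(a, i). 1 \<le> i \<and> i \<le> length r \<and> 1 \<le> a \<and> a \<le> r ! (i - 1)}"

text \<open>The relation \<open><\<close> on pairs is the strict part of the componentwise order.\<close>

definition gorenstein :: "nat list \<Rightarrow> bool" where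
  "gorenstein r \<longleftrightarrow>
     (\<forall>C D. pred_on.maxchain (order_ideal r) (<) C \<longrightarrow> pred_on.maxchain (order_ideal r) (<) D \<longrightarrow>
        card C = card D)"

end

theory Submission
  imports Defs
begin

text \<open>
  Both sides count the compositions \<open>(b\<^sub>1, \<dots>, b\<^sub>m)\<close> with
  \<open>\<Sum>i<j. b\<^sub>i * b\<^sub>j = k\<close> that have at least two parts or are the composition \<open>(1)\<close>.

  A permutation avoids 132 and 213 iff it is a sequence of blocks of consecutive increasing
  values, each block lying entirely below the preceding one: after the first entry \<open>a\<close>, the
  larger entries must come first (213) and in increasing order (132), and one recurses on the
  smaller ones. The block lengths form a composition. The inversions are the pairs of entries in
  different blocks, so they are counted by \<open>\<Sum>i<j. b\<^sub>i * b\<^sub>j\<close>. With at least two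
  blocks the first entry exceeds the last, so the permutation is indecomposable; with one block
  it is an identity, which is indecomposable only in length 1.

  The maximal elements of the order ideal of a partition are the corners of its diagram. The
  ideal is graded by the sum of the coordinates, and every maximal chain runs from \<open>(1, 1)\<close> to a
  corner without skipping a rank. So the partition is Gorenstein iff all its corners \<open>(a, i)\<close> have
  the same \<open>a + i = N\<close>. Reading the boundary from corner to corner then gives a composition of
  \<open>N\<close>: for each \<open>j < m\<close> the diagram has \<open>b\<^sub>j\<close> rows of length \<open>b\<^sub>j\<^sub>+\<^sub>1 + \<dots> + b\<^sub>m\<close>,
  of total size \<open>\<Sum>i<j. b\<^sub>i * b\<^sub>j\<close>. These row lengths are the nonzero entries of the Lehmer
  code of the permutation with the same composition.

  The two bijections are \<open>bij_betw_rev_layered\<close> and \<open>bij_betw_shape\<close>.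
\<close>

section \<open>Compositions\<close>

text \<open>The sum \<open>\<Sum>i<j. b\<^sub>i * b\<^sub>j\<close> over all pairs of parts of a list.\<close>

fun pair_sum :: "nat list \<Rightarrow> nat" where
  "pair_sum [] = 0"
| "pair_sum (b # bs) = b * sum_list bs + pair_sum bs"

text \<open>
  Compositions are lists without the entry 0. Every one-part composition has pair sum 0; only
  \<open>[1]\<close> is kept, which corresponds to the permutation 1 and to the empty partition.
\<close>

definition admissible :: "nat \<Rightarrow> nat list set" where
  "admissible k = {bs. 0 \<notin> set bs \<and> (bs = [1] \<or> 2 \<le> length bs) \<and> pair_sum bs = k}"

section \<open>Permutations avoiding 132 and 213\<close>

text \<open>
  The permutation whose blocks, from left to right, are increasing runs of consecutive values
  of the given lengths, each block lying below the preceding one.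
\<close>

fun rev_layered :: "nat list \<Rightarrow> nat list" where
  "rev_layered [] = []"
| "rev_layered (b # bs) = [Suc (sum_list bs)..<Suc (sum_list bs + b)] @ rev_layered bs"

lemma is_perm_iff: "is_perm p \<longleftrightarrow> set p = {1..length p} \<and> distinct p"
  unfolding is_perm_def permutations_of_set_def by auto

lemma length_rev_layered [simp]: "length (rev_layered bs) = sum_list bs"
  by (induction bs) auto

lemma set_rev_layered: "set (rev_layered bs) = {1..sum_list bs}"
  by (induction bs) auto

lemma is_perm_rev_layered: "is_perm (rev_layered bs)"
proof -
  have "distinct (rev_layered bs)"
    by (induction bs) (auto simp: set_rev_layered)
  then show ?thesis
    by (simp add: is_perm_iff set_rev_layered)
qed

lemma rev_layered_inject:
  assumes "rev_layered bs = rev_layered cs" "0 \<notin> set bs" "0 \<notin> set cs"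
  shows "bs = cs"
  using assms
proof (induction bs arbitrary: cs)
  case Nil
  then have "sum_list cs = 0"
    by (metis length_rev_layered list.size(3) rev_layered.simps(1))
  with Nil.prems show ?case
    by (cases cs) auto
next
  case (Cons b bs)
  have tot: "b + sum_list bs = sum_list cs"
    using arg_cong[OF Cons.prems(1), of length] by (simp del: upt_Suc)
  then obtain c cs' where cs: "cs = c # cs'"
    using Cons.prems(2) by (cases cs) auto
  have pos: "b > 0" "c > 0"
    using Cons.prems cs by auto
  have hd: "hd (rev_layered (x # xs)) = Suc (sum_list xs)" if "x > 0" for x xs
    using that by (simp add: hd_append upt_conv_Cons)
  have "sum_list bs = sum_list cs'"
    using Cons.prems(1) hd[OF pos(1)] hd[OF pos(2)] cs by (metis Suc_inject)
  with tot cs have "b = c" by simp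
  with \<open>sum_list bs = sum_list cs'\<close> Cons cs show ?case by auto
qed

lemma contains_132_iff:
  "contains p [1, 3, 2] \<longleftrightarrow>
     (\<exists>i j l. i < j \<and> j < l \<and> l < length p \<and> p ! i < p ! l \<and> p ! l < p ! j)"
proof
  assume "contains p [1, 3, 2]"
  then obtain f where f: "strict_mono_on {..<3} f" "f ` {..<3} \<subseteq> {..<length p}"
    "\<forall>a<3. \<forall>b<3. p ! f a < p ! f b \<longleftrightarrow> [1, 3, 2::nat] ! a < [1, 3, 2] ! b"
    unfolding contains_def by (auto simp: numeral_3_eq_3)
  have "f 0 < f 1" "f 1 < f 2"
    using f(1) by (auto simp: strict_mono_on_def)
  moreover have "f 2 < length p"
    using f(2) by (simp add: image_subset_iff)
  moreover have "p ! f 0 < p ! f 2" "p ! f 2 < p ! f 1"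
    using f(3)[rule_format, of 0 2] f(3)[rule_format, of 2 1] by auto
  ultimately show "\<exists>i j l. i < j \<and> j < l \<and> l < length p \<and> p ! i < p ! l \<and> p ! l < p ! j"
    by blast
next
  assume "\<exists>i j l. i < j \<and> j < l \<and> l < length p \<and> p ! i < p ! l \<and> p ! l < p ! j"
  then obtain i j l where "i < j" "j < l" "l < length p" "p ! i < p ! l" "p ! l < p ! j"
    by blast
  then show "contains p [1, 3, 2]"
    unfolding contains_def
    by (intro exI[of _ "\<lambda>a. [i, j, l] ! a"])
       (auto simp: strict_mono_on_def less_Suc_eq numeral_2_eq_2)
qed

lemma contains_213_iff:
  "contains p [2, 1, 3] \<longleftrightarrow>
     (\<exists>i j l. i < j \<and> j < l \<and> l < length p \<and> p ! j < p ! i \<and> p ! i < p ! l)"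
proof
  assume "contains p [2, 1, 3]"
  then obtain f where f: "strict_mono_on {..<3} f" "f ` {..<3} \<subseteq> {..<length p}"
    "\<forall>a<3. \<forall>b<3. p ! f a < p ! f b \<longleftrightarrow> [2, 1, 3::nat] ! a < [2, 1, 3] ! b"
    unfolding contains_def by (auto simp: numeral_3_eq_3)
  have "f 0 < f 1" "f 1 < f 2"
    using f(1) by (auto simp: strict_mono_on_def)
  moreover have "f 2 < length p"
    using f(2) by (simp add: image_subset_iff)
  moreover have "p ! f 1 < p ! f 0" "p ! f 0 < p ! f 2"
    using f(3)[rule_format, of 1 0] f(3)[rule_format, of 0 2] by auto
  ultimately show "\<exists>i j l. i < j \<and> j < l \<and> l < length p \<and> p ! j < p ! i \<and> p ! i < p ! l"
    by blast
next
  assume "\<exists>i j l. i < j \<and> j < l \<and> l < length p \<and> p ! j < p ! i \<and> p ! i < p ! l"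
  then obtain i j l where "i < j" "j < l" "l < length p" "p ! j < p ! i" "p ! i < p ! l"
    by blast
  then show "contains p [2, 1, 3]"
    unfolding contains_def
    by (intro exI[of _ "\<lambda>a. [i, j, l] ! a"])
       (auto simp: strict_mono_on_def less_Suc_eq numeral_2_eq_2)
qed

text \<open>
  Two entries that are not inverted lie in one block, and then so does everything between them.
  This excludes both patterns at once.
\<close>

lemma rev_layered_noninversion:
  assumes "i < j" "j < l" "l < length (rev_layered bs)" "rev_layered bs ! i < rev_layered bs ! l"
  shows "rev_layered bs ! i < rev_layered bs ! j \<and> rev_layered bs ! j < rev_layered bs ! l"
  using assms
proof (induction bs arbitrary: i j l)
  case Nil
  then show ?case by simp
next
  case (Cons b bs)
  let ?B = "[Suc (sum_list bs)..<Suc (sum_list bs + b)]"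
  have low: "rev_layered bs ! m \<le> sum_list bs" if "m < sum_list bs" for m
    using nth_mem[of m "rev_layered bs"] that by (simp add: set_rev_layered)
  have nth: "rev_layered (b # bs) ! m
      = (if m < b then Suc (sum_list bs + m) else rev_layered bs ! (m - b))" for m
    by (auto simp: nth_append simp del: upt_Suc)
  show ?case
  proof (cases "i < b")
    case True
    have "l < b"
    proof (rule ccontr)
      assume "\<not> l < b"
      moreover from this have "l - b < sum_list bs"
        using Cons.prems(3) by (simp only: length_rev_layered sum_list.Cons)
      ultimately show False
        using Cons.prems(4) low[of "l - b"] True by (simp add: nth del: rev_layered.simps)
    qed
    with Cons.prems True show ?thesis
      by (auto simp: nth simp del: rev_layered.simps)
  next
    case False
    then show ?thesis
      using Cons.IH[of "i - b" "j - b" "l - b"] Cons.prems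
      by (auto simp: nth simp del: rev_layered.simps)
  qed
qed

lemma rev_layered_avoids:
  "avoids (rev_layered bs) [1, 3, 2]" "avoids (rev_layered bs) [2, 1, 3]"
  unfolding contains_132_iff contains_213_iff
  using rev_layered_noninversion by (meson less_asym)+

lemma avoider_is_rev_layered:
  assumes "is_perm p" "avoids p [1, 3, 2]" "avoids p [2, 1, 3]"
  shows "\<exists>bs. 0 \<notin> set bs \<and> p = rev_layered bs"
  using assms
proof (induction p rule: length_induct)
  case (1 p)
  show ?case
  proof (cases p)
    case Nil
    then show ?thesis by (intro exI[of _ "[]"]) simp
  next
    case (Cons a q)
    \<comment> \<open>Avoiding 213 forces all entries of \<open>L\<close> below \<open>a\<close>; avoiding 132 makes \<open>U\<close> increasing.\<close>
    define U where "U = takeWhile (\<lambda>x. a < x) q"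
    define L where "L = dropWhile (\<lambda>x. a < x) q"
    have q: "q = U @ L" by (simp add: U_def L_def)
    have p: "p = (a # U) @ L" by (simp add: Cons q)
    have setp: "set p = {1..length p}" and dist: "distinct p"
      using "1.prems"(1) by (auto simp: is_perm_iff)
    have no132: False if "i < j" "j < l" "l < length p" "p ! i < p ! l" "p ! l < p ! j" for i j l
      using "1.prems"(2) that unfolding contains_132_iff by blast
    have no213: False if "i < j" "j < l" "l < length p" "p ! j < p ! i" "p ! i < p ! l" for i j l
      using "1.prems"(3) that unfolding contains_213_iff by blast
    have U: "a < x" if "x \<in> set U" for x
      using that unfolding U_def by (rule set_takeWhileD[THEN conjunct2])
    have L: "x < a" if "x \<in> set L" for x
    proof -
      from that obtain m where m: "m < length L" "x = L ! m"
        by (metis in_set_conv_nth)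
      have ne: "L ! m' \<noteq> a" if "m' < length L" for m'
        using dist nth_mem[OF that] p by auto
      have "\<not> a < L ! 0"
        using hd_dropWhile[of "\<lambda>x. a < x" q] m(1) unfolding L_def
        by (metis hd_conv_nth length_greater_0_conv less_nat_zero_code neq0_conv)
      then have less0: "L ! 0 < a"
        using ne[of 0] m(1) by force
      show "x < a"
      proof (rule ccontr)
        assume "\<not> x < a"
        with ne[OF m(1)] m(2) have "a < x" by simp
        then have "m > 0" using less0 m(2) by (cases m) auto
        then show False
          using no213[of 0 "Suc (length U)" "Suc (length U) + m"] m less0 \<open>a < x\<close>
          by (simp add: p nth_append)
      qed
    qed
    have "sorted_wrt (<) (a # U)"
    proof -
      have "U ! i < U ! j" if "i < j" "j < length U" for i j
      proof (rule ccontr)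
        assume "\<not> U ! i < U ! j"
        moreover have "U ! i \<noteq> U ! j"
          using dist that p by (simp add: nth_eq_iff_index_eq)
        ultimately have "U ! j < U ! i" by simp
        then show False
          using no132[of 0 "Suc i" "Suc j"] that U by (simp add: p nth_append)
      qed
      then have "sorted_wrt (<) U" by (simp add: sorted_wrt_iff_nth_less)
      then show ?thesis using U by simp
    qed
    have a: "1 \<le> a" "a \<le> length p"
      using setp p by auto
    have setU: "set (a # U) = {a..<Suc (length p)}"
    proof -
      have "set (a # U) = {x \<in> set p. a \<le> x}"
        using U L by (force simp: p)
      then show ?thesis using setp a by auto
    qed
    have setL: "set L = {1..a - 1}"
    proof -
      have "set L = {x \<in> set p. x < a}"
        using U L by (force simp: p)
      then show ?thesis using setp a by auto
    qed
    have aU: "a # U = [a..<Suc (length p)]"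
    proof (rule sorted_distinct_set_unique)
      show "sorted (a # U)" "distinct (a # U)"
        using \<open>sorted_wrt (<) (a # U)\<close> by (simp_all only: strict_sorted_iff)
      show "set (a # U) = set [a..<Suc (length p)]"
        by (simp only: setU set_upt)
    qed (simp_all del: upt_Suc)
    have distL: "distinct L" using dist by (simp add: p)
    have lenL: "length L = a - 1"
      using distinct_card[OF distL] setL by simp
    have permL: "is_perm L"
      by (simp add: is_perm_iff setL lenL distL)
    have suffix: "L ! i = p ! (i + Suc (length U))" for i
      by (simp add: p nth_append)
    have "avoids L [1, 3, 2]"
      unfolding contains_132_iff suffix
    proof clarify
      fix i j l
      assume "i < j" "j < l" "l < length L" "p ! (i + Suc (length U)) < p ! (l + Suc (length U))"
        "p ! (l + Suc (length U)) < p ! (j + Suc (length U))"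
      then show False
        using no132[of "i + Suc (length U)" "j + Suc (length U)" "l + Suc (length U)"]
        by (simp add: p)
    qed
    moreover have "avoids L [2, 1, 3]"
      unfolding contains_213_iff suffix
    proof clarify
      fix i j l
      assume "i < j" "j < l" "l < length L" "p ! (j + Suc (length U)) < p ! (i + Suc (length U))"
        "p ! (i + Suc (length U)) < p ! (l + Suc (length U))"
      then show False
        using no213[of "i + Suc (length U)" "j + Suc (length U)" "l + Suc (length U)"]
        by (simp add: p)
    qed
    moreover have "length L < length p"
      by (simp add: p)
    ultimately obtain bs where bs: "0 \<notin> set bs" "L = rev_layered bs"
      using "1.IH" permL by blast
    have "sum_list bs = a - 1"
      using lenL bs(2) by simp
    then have "rev_layered ((Suc (length p) - a) # bs) = [a..<Suc (length p)] @ L"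
      using a bs(2) by (simp del: upt_Suc)
    also have "\<dots> = p"
      using p aU by metis
    finally show ?thesis
      using a bs(1) by (intro exI[of _ "(Suc (length p) - a) # bs"]) auto
  qed
qed

lemma finite_inversions: "finite (inversions p)"
  by (rule finite_subset[of _ "{..<length p} \<times> {..<length p}"]) (auto simp: inversions_def)

lemma card_inversions_append:
  assumes "sorted_wrt (<) xs" "\<And>x y. x \<in> set xs \<Longrightarrow> y \<in> set ys \<Longrightarrow> y < x"
  shows "card (inversions (xs @ ys)) = length xs * length ys + card (inversions ys)"
proof -
  let ?n = "length xs"
  let ?s = "\<lambda>(i, j). (i + ?n, j + ?n)"
  have inc: "xs ! i < xs ! j" if "i < j" "j < ?n" for i j
    using assms(1) that by (simp add: sorted_wrt_iff_nth_less)
  have dec: "ys ! j < xs ! i" if "i < ?n" "j < length ys" for i j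
    using assms(2) that by simp
  have "inversions (xs @ ys) = {..<?n} \<times> {?n..<?n + length ys} \<union> ?s ` inversions ys"
  proof (rule set_eqI, clarify)
    fix i j
    have "(i, j) \<in> ?s ` inversions ys \<longleftrightarrow> ?n \<le> i \<and> ?n \<le> j \<and> (i - ?n, j - ?n) \<in> inversions ys"
      by (force simp: image_iff)
    then show "(i, j) \<in> inversions (xs @ ys)
        \<longleftrightarrow> (i, j) \<in> {..<?n} \<times> {?n..<?n + length ys} \<union> ?s ` inversions ys"
      using inc[of i j] dec[of i "j - ?n"] by (auto simp: inversions_def nth_append)
  qed
  moreover have "card (?s ` inversions ys) = card (inversions ys)"
    by (rule card_image) (auto simp: inj_on_def)
  moreover have "({..<?n} \<times> {?n..<?n + length ys}) \<inter> ?s ` inversions ys = {}"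
    by auto
  ultimately show ?thesis
    by (simp add: card_Un_disjoint finite_inversions)
qed

lemma card_inversions_rev_layered: "card (inversions (rev_layered bs)) = pair_sum bs"
proof (induction bs)
  case Nil
  then show ?case by (simp add: inversions_def)
next
  case (Cons b bs)
  then show ?case
    using card_inversions_append[of "[Suc (sum_list bs)..<Suc (sum_list bs + b)]" "rev_layered bs"]
    by (simp add: set_rev_layered strict_sorted_iff del: upt_Suc)
qed

lemma indecomposable_rev_layered_iff:
  assumes "0 \<notin> set bs"
  shows "indecomposable (rev_layered bs) \<longleftrightarrow> bs = [1] \<or> 2 \<le> length bs"
proof (cases bs)
  case Nil
  then show ?thesis by (simp add: indecomposable_def)
next
  case (Cons b cs)
  have b: "b > 0" using assms Cons by simp
  have perm: "is_perm (rev_layered bs)" by (rule is_perm_rev_layered)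
  show ?thesis
  proof (cases cs)
    case Nil
    \<comment> \<open>A single block is the identity permutation of length \<open>b\<close>, which splits unless \<open>b = 1\<close>.\<close>
    show ?thesis
    proof (cases "b = 1")
      case True
      then have "rev_layered bs = [1]" using Cons Nil by simp
      then have "\<not> decomposable (rev_layered bs)"
        by (auto simp: decomposable_def perm_sum_def Cons_eq_append_conv)
      with True Cons Nil perm \<open>rev_layered bs = [1]\<close> show ?thesis
        by (auto simp: indecomposable_def)
    next
      case False
      have "rev_layered bs = perm_sum (rev_layered [1]) (rev_layered [b - 1])"
        using Cons Nil b by (simp add: perm_sum_def map_Suc_upt upt_conv_Cons del: upt_Suc)
      moreover have "rev_layered [1] \<noteq> []" "rev_layered [b - 1] \<noteq> []"
        using False b by auto
      ultimately have "decomposable (rev_layered bs)"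
        unfolding decomposable_def using is_perm_rev_layered by blast
      with False Cons Nil show ?thesis by (simp add: indecomposable_def)
    qed
  next
    case (Cons c ds)
    have c: "sum_list cs > 0" using assms \<open>bs = b # cs\<close> Cons by auto
    have bs: "rev_layered bs = [Suc (sum_list cs)..<Suc (sum_list cs + b)] @ rev_layered cs"
      using \<open>bs = b # cs\<close> by simp
    have ne: "rev_layered cs \<noteq> []"
      using c by (metis length_rev_layered list.size(3) less_irrefl)
    have hd: "hd (rev_layered bs) = Suc (sum_list cs)"
      unfolding bs using b by (simp add: hd_append del: upt_Suc)
    have "last (rev_layered cs) \<in> {1..sum_list cs}"
      using last_in_set[OF ne] by (simp only: set_rev_layered)
    then have last: "last (rev_layered bs) \<le> sum_list cs"
      unfolding bs using ne by simp
    \<comment> \<open>In a proper sum, the first entry is smaller than the last.\<close>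
    have "\<not> decomposable (rev_layered bs)"
    proof
      assume "decomposable (rev_layered bs)"
      then obtain r t where rt: "is_perm r" "is_perm t" "r \<noteq> []" "t \<noteq> []" "rev_layered bs = perm_sum r t"
        unfolding decomposable_def by blast
      have "hd (rev_layered bs) = hd r" "last (rev_layered bs) = length r + last t"
        using rt by (simp_all add: perm_sum_def last_map)
      moreover have "hd r \<in> {1..length r}"
        using rt(1) hd_in_set[OF rt(3)] by (simp add: is_perm_iff)
      ultimately show False using hd last by simp
    qed
    moreover have "rev_layered bs \<noteq> []" using ne bs by simp
    ultimately show ?thesis
      using perm \<open>bs = b # cs\<close> Cons by (simp add: indecomposable_def)
  qed
qed

lemma bij_betw_rev_layered:
  "bij_betw rev_layered (admissible k) (indec_avoiders k {[1, 3, 2], [2, 1, 3]})"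
proof (rule bij_betwI')
  fix bs cs assume "bs \<in> admissible k" "cs \<in> admissible k"
  then show "rev_layered bs = rev_layered cs \<longleftrightarrow> bs = cs"
    using rev_layered_inject by (auto simp: admissible_def)
next
  fix bs assume "bs \<in> admissible k"
  then show "rev_layered bs \<in> indec_avoiders k {[1, 3, 2], [2, 1, 3]}"
    using rev_layered_avoids
    by (auto simp: admissible_def indec_avoiders_def card_inversions_rev_layered indecomposable_rev_layered_iff)
next
  fix p assume "p \<in> indec_avoiders k {[1, 3, 2], [2, 1, 3]}"
  then have p: "indecomposable p" "card (inversions p) = k" "avoids p [1, 3, 2]" "avoids p [2, 1, 3]"
    by (auto simp: indec_avoiders_def)
  then obtain bs where bs: "0 \<notin> set bs" "p = rev_layered bs"
    using avoider_is_rev_layered by (metis indecomposable_def)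
  then show "\<exists>bs\<in>admissible k. p = rev_layered bs"
    using p(1,2) by (auto simp: admissible_def card_inversions_rev_layered indecomposable_rev_layered_iff)
qed

section \<open>Gorenstein partitions and corners\<close>

text \<open>
  The corners of the diagram, indexed by their rows counted from 0 as list positions: a corner
  \<open>i\<close> stands for the maximal element \<open>(r ! i, Suc i)\<close> of the order ideal.
\<close>

definition corner :: "nat list \<Rightarrow> nat \<Rightarrow> bool" where
  "corner r i \<longleftrightarrow> i < length r \<and> (Suc i < length r \<longrightarrow> r ! Suc i < r ! i)"

text \<open>All corners lie on the antidiagonal on which the coordinates add up to \<open>N\<close>.\<close>

definition level :: "nat \<Rightarrow> nat list \<Rightarrow> bool" where
  "level N r \<longleftrightarrow> (\<forall>i. corner r i \<longrightarrow> r ! i + Suc i = N)"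

text \<open>A chain is maximal iff it contains each element that is comparable to all of its members.\<close>

lemma maxchain_iff:
  fixes A :: "'a :: order set"
  shows "pred_on.maxchain A (<) C \<longleftrightarrow>
     C \<subseteq> A \<and> (\<forall>x\<in>C. \<forall>y\<in>C. x \<le> y \<or> y \<le> x) \<and> (\<forall>z\<in>A. (\<forall>w\<in>C. w \<le> z \<or> z \<le> w) \<longrightarrow> z \<in> C)"
    (is "_ \<longleftrightarrow> ?R")
proof -
  have chain: "pred_on.chain A (<) D \<longleftrightarrow> D \<subseteq> A \<and> (\<forall>x\<in>D. \<forall>y\<in>D. x \<le> y \<or> y \<le> x)" for D
    unfolding pred_on.chain_def by (auto simp: order.order_iff_strict)
  show ?thesis
  proof
    assume max: "pred_on.maxchain A (<) C"
    have "z \<in> C" if "z \<in> A" "\<forall>w\<in>C. w \<le> z \<or> z \<le> w" for z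
    proof (rule ccontr)
      assume "z \<notin> C"
      moreover have "pred_on.chain A (<) (insert z C)"
        using max that by (auto simp: pred_on.maxchain_def chain)
      ultimately show False
        using max by (auto simp: pred_on.maxchain_def)
    qed
    with max show ?R by (auto simp: pred_on.maxchain_def chain)
  next
    assume R: ?R
    have "D \<subseteq> C" if "pred_on.chain A (<) D" "C \<subseteq> D" for D
    proof
      fix z assume "z \<in> D"
      with that R show "z \<in> C" unfolding chain by blast
    qed
    moreover have "pred_on.chain A (<) C"
      unfolding chain using R by blast
    ultimately show "pred_on.maxchain A (<) C"
      unfolding pred_on.maxchain_def by blast
  qed
qed

lemma order_ideal_down:
  assumes "sorted_wrt (\<ge>) r" "(a, i) \<in> order_ideal r" "1 \<le> a'" "a' \<le> a" "1 \<le> i'" "i' \<le> i"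
  shows "(a', i') \<in> order_ideal r"
proof -
  have "r ! (i - 1) \<le> r ! (i' - 1)"
  proof (cases "i' = i")
    case False
    then show ?thesis
      using assms by (auto simp: order_ideal_def sorted_wrt_iff_nth_less)
  qed simp
  with assms show ?thesis by (auto simp: order_ideal_def)
qed

lemma finite_order_ideal: "finite (order_ideal r)"
proof (rule finite_subset)
  show "order_ideal r \<subseteq> {..sum_list r} \<times> {..length r}"
  proof clarify
    fix a i assume "(a, i) \<in> order_ideal r"
    moreover from this have "r ! (i - 1) \<le> sum_list r"
      by (intro elem_le_sum_list) (auto simp: order_ideal_def)
    ultimately show "a \<in> {..sum_list r} \<and> i \<in> {..length r}"
      by (auto simp: order_ideal_def)
  qed
qed simp

lemma corner_is_maximal:
  assumes "sorted_wrt (\<ge>) r" "corner r i" "(u, v) \<in> order_ideal r" "r ! i \<le> u" "Suc i \<le> v"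
  shows "u = r ! i \<and> v = Suc i"
proof -
  have ri: "r ! i \<le> r ! i'" if "i' \<le> i" for i'
    using assms(1,2) that by (cases "i' = i") (auto simp: corner_def sorted_wrt_iff_nth_less)
  have uv: "1 \<le> v" "v \<le> length r" "u \<le> r ! (v - 1)"
    using assms(3) by (auto simp: order_ideal_def)
  have "v = Suc i"
  proof (rule ccontr)
    assume "v \<noteq> Suc i"
    with assms(5) have "Suc i \<le> v - 1" by simp
    then have "r ! (v - 1) \<le> r ! Suc i"
      using assms(1) uv by (cases "Suc i = v - 1") (auto simp: sorted_wrt_iff_nth_less)
    moreover have "r ! Suc i < r ! i"
      using assms(2) \<open>Suc i \<le> v - 1\<close> uv by (simp add: corner_def)
    ultimately show False using assms(4) uv by simp
  qed
  with uv assms(4) show ?thesis by simp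
qed

lemma maximal_is_corner:
  assumes "(a, i) \<in> order_ideal r" "(Suc a, i) \<notin> order_ideal r" "(a, Suc i) \<notin> order_ideal r"
  shows "corner r (i - 1) \<and> a = r ! (i - 1)"
proof -
  from assms(1) have i: "1 \<le> i" "i \<le> length r" "1 \<le> a" "a \<le> r ! (i - 1)"
    by (simp_all add: order_ideal_def)
  have "r ! (i - 1) < Suc a"
    using assms(2) i by (simp add: order_ideal_def)
  moreover have "r ! i < a" if "i < length r"
    using assms(3) i that by (simp add: order_ideal_def)
  moreover have "i - 1 < length r" "Suc (i - 1) = i"
    using i by simp_all
  ultimately show ?thesis
    using i by (auto simp only: corner_def less_Suc_eq_le intro: order.antisym order.strict_trans2)
qed

text \<open>
  Each corner is the top of some maximal chain: go along the first row to the column of the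
  corner, then along that column.
\<close>

lemma hook_maxchain:
  assumes "sorted_wrt (\<ge>) r" "\<forall>x\<in>set r. 1 \<le> x" "corner r i"
  shows "\<exists>C. pred_on.maxchain (order_ideal r) (<) C \<and> card C = r ! i + i"
proof -
  define a where "a = r ! i"
  let ?C = "{1..a} \<times> {1} \<union> {a} \<times> {2..Suc i}"
  have i: "i < length r" using assms(3) by (simp add: corner_def)
  then have "1 \<le> a" using assms(2) by (simp add: a_def)
  then have top: "(a, Suc i) \<in> order_ideal r"
    using i by (simp add: order_ideal_def a_def)
  have "pred_on.maxchain (order_ideal r) (<) ?C"
    unfolding maxchain_iff
  proof (intro conjI ballI impI)
    show "?C \<subseteq> order_ideal r"
      using order_ideal_down[OF assms(1) top] \<open>1 \<le> a\<close> by auto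
    show "x \<le> y \<or> y \<le> x" if "x \<in> ?C" "y \<in> ?C" for x y
      using that by (auto simp: less_eq_prod_def)
  next
    fix z assume z: "z \<in> order_ideal r" "\<forall>w\<in>?C. w \<le> z \<or> z \<le> w"
    obtain u v where uv: "z = (u, v)" by fastforce
    have pos: "1 \<le> u" "1 \<le> v" using z(1) uv by (auto simp: order_ideal_def)
    have "(a, Suc i) \<in> ?C" using \<open>1 \<le> a\<close> by (cases i) auto
    then have "(a, Suc i) \<le> z \<or> z \<le> (a, Suc i)" using z(2) by blast
    then have "u \<le> a \<and> v \<le> Suc i"
      using corner_is_maximal[OF assms(1,3), of u v] z(1) by (auto simp: uv a_def)
    moreover have "(a, 1) \<le> z \<or> z \<le> (a, 1)" using z(2) \<open>1 \<le> a\<close> by auto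
    ultimately show "z \<in> ?C" using pos by (auto simp: uv)
  qed
  moreover have "card ?C = a + i"
    by (subst card_Un_disjoint) auto
  ultimately show ?thesis unfolding a_def by blast
qed

text \<open>
  The sum of the coordinates maps a maximal chain bijectively onto \<open>{2..N}\<close>. It does not skip a
  value, because between two elements whose sums differ by at least 2 there is a further
  element of the ideal.
\<close>

lemma level_card_maxchain:
  assumes "sorted_wrt (\<ge>) r" "\<forall>x\<in>set r. 1 \<le> x" "level N r" "r \<noteq> []"
    and max: "pred_on.maxchain (order_ideal r) (<) C"
  shows "card C = N - 1"
proof -
  let ?f = "\<lambda>x :: nat \<times> nat. fst x + snd x"
  have sub: "C \<subseteq> order_ideal r" and chain: "\<And>x y. x \<in> C \<Longrightarrow> y \<in> C \<Longrightarrow> x \<le> y \<or> y \<le> x"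
    and ext: "\<And>z. z \<in> order_ideal r \<Longrightarrow> (\<And>w. w \<in> C \<Longrightarrow> w \<le> z \<or> z \<le> w) \<Longrightarrow> z \<in> C"
    using max unfolding maxchain_iff by blast+
  have fin: "finite C" using sub finite_order_ideal finite_subset by blast
  have mono: "?f x < ?f y" if "x < y" for x y
    using that by (cases x; cases y) (auto simp: less_prod_def)
  have inj: "inj_on ?f C"
  proof (rule inj_onI)
    fix x y assume "x \<in> C" "y \<in> C" "?f x = ?f y"
    then show "x = y" using chain[of x y] mono[of x y] mono[of y x]
      by (auto simp: order.order_iff_strict)
  qed
  have pos: "1 \<le> fst x \<and> 1 \<le> snd x" if "x \<in> C" for x
    using that sub by (force simp: order_ideal_def)
  have bot: "(1, 1) \<in> C"
  proof (rule ext)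
    show "(1, 1) \<in> order_ideal r"
      using assms(2,4) by (cases r) (auto simp: order_ideal_def)
  qed (use pos in \<open>auto simp: less_eq_prod_def\<close>)
  have step: "Suc (?f x) \<in> ?f ` C" if x: "x \<in> C" "?f x \<noteq> N" for x
  proof -
    obtain a i where ai: "x = (a, i)" by fastforce
    show ?thesis
    proof (cases "\<exists>y\<in>C. x < y")
      case True
      then obtain y where y: "y \<in> C" "x < y" and least: "\<And>w. w \<in> C \<and> x < w \<Longrightarrow> ?f y \<le> ?f w"
        using ex_has_least_nat[of "\<lambda>y. y \<in> C \<and> x < y" _ ?f] by blast
      \<comment> \<open>\<open>y\<close> is the successor of \<open>x\<close> in \<open>C\<close>, and \<open>z\<close> is a unit step from \<open>x\<close> towards \<open>y\<close>.\<close>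
      define z where "z = (if a < fst y then (Suc a, i) else (a, Suc i))"
      have z: "x \<le> z" "z \<le> y" "?f z = Suc (?f x)"
        using y(2) by (auto simp: z_def ai less_prod_def less_eq_prod_def split: if_splits)
      have "z \<in> C"
      proof (rule ext)
        have "(fst y, snd y) \<in> order_ideal r" using y(1) sub by auto
        moreover have "1 \<le> fst z" "1 \<le> snd z"
          using pos[OF x(1)] z(1) by (auto simp: less_eq_prod_def)
        ultimately show "z \<in> order_ideal r"
          using order_ideal_down[OF assms(1), of "fst y" "snd y" "fst z" "snd z"] z(2)
          by (simp add: less_eq_prod_def)
      next
        fix w assume w: "w \<in> C"
        show "w \<le> z \<or> z \<le> w"
        proof (cases "w \<le> x")
          case True
          then show ?thesis using z(1) by (blast intro: order.trans)
        next
          case False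
          then have "x < w" using chain[OF x(1) w] by (simp add: less_le_not_le)
          then have "?f y \<le> ?f w" using least w by simp
          then have "\<not> w < y" using mono[of w y] by linarith
          then have "y \<le> w" using chain[OF w y(1)] by (auto simp only: less_le_not_le)
          then show ?thesis using z(2) by (blast intro: order.trans)
        qed
      qed
      then have "?f z \<in> ?f ` C" by (rule imageI)
      then show ?thesis by (simp only: z(3))
    next
      case False
      \<comment> \<open>The top of a maximal chain is a maximal element of the ideal, hence a corner.\<close>
      then have below: "w \<le> x" if "w \<in> C" for w
        using chain[OF x(1) that] that by (auto simp: order.order_iff_strict)
      have no: "z \<notin> order_ideal r" if "x < z" for z
      proof
        assume "z \<in> order_ideal r"
        then have "z \<in> C"
          using ext[of z] below that by (meson order.strict_implies_order order.trans)
        with False that show False by blast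
      qed
      have "corner r (i - 1) \<and> a = r ! (i - 1)"
        using x(1) sub no[of "(Suc a, i)"] no[of "(a, Suc i)"]
        by (intro maximal_is_corner) (auto simp: ai less_prod_def)
      then have "a + Suc (i - 1) = N" using assms(3) by (auto simp: level_def)
      then show ?thesis using x pos[OF x(1)] by (simp add: ai)
    qed
  qed
  have "?f x \<le> N" if "x \<in> C" for x
  proof -
    define m where "m = Max (?f ` C)"
    have "m \<in> ?f ` C" unfolding m_def using fin bot by (intro Max_in) auto
    moreover have m: "t \<le> m" if "t \<in> ?f ` C" for t
      unfolding m_def using fin that by simp
    ultimately have "m = N" using step m by fastforce
    with m that show ?thesis by blast
  qed
  moreover have "s \<in> ?f ` C" if "2 \<le> s" "s \<le> N" for s
    using that
  proof (induction s rule: dec_induct)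
    case base
    show ?case using bot by (force simp: image_iff)
  next
    case (step s)
    then obtain x where "x \<in> C" "s = ?f x" by auto
    with step \<open>\<And>x. x \<in> C \<Longrightarrow> ?f x \<noteq> N \<Longrightarrow> Suc (?f x) \<in> ?f ` C\<close>[of x] show ?case by auto
  qed
  ultimately have "?f ` C = {2..N}" using pos by force
  then have "card (?f ` C) = N - 1" by simp
  then show ?thesis using card_image[OF inj] by simp
qed

lemma gorenstein_iff_level:
  assumes "sorted_wrt (\<ge>) r" "\<forall>x\<in>set r. 1 \<le> x"
  shows "gorenstein r \<longleftrightarrow> (\<exists>N. level N r)"
proof
  assume gor: "gorenstein r"
  have "r ! i + Suc i = r ! j + Suc j" if i: "corner r i" and j: "corner r j" for i j
  proof -
    obtain C D where "pred_on.maxchain (order_ideal r) (<) C" "card C = r ! i + i"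
      "pred_on.maxchain (order_ideal r) (<) D" "card D = r ! j + j"
      using hook_maxchain[OF assms i] hook_maxchain[OF assms j] by blast
    moreover from this have "card C = card D"
      using gor unfolding gorenstein_def by blast
    ultimately show ?thesis by simp
  qed
  then show "\<exists>N. level N r" unfolding level_def by metis
next
  assume "\<exists>N. level N r"
  then obtain N where N: "level N r" ..
  show "gorenstein r"
  proof (cases "r = []")
    case True
    then have "order_ideal r = {}" by (auto simp: order_ideal_def)
    then show ?thesis by (auto simp: gorenstein_def maxchain_iff)
  next
    case False
    then show ?thesis
      using level_card_maxchain[OF assms N] by (simp add: gorenstein_def)
  qed
qed

section \<open>Gorenstein partitions from compositions\<close>

text \<open>
  The partition with \<open>b\<close> rows of length \<open>s\<close> for each part \<open>b\<close> but the last, where \<open>s\<close> is the sum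
  of the later parts. The last part is dropped since its rows would have length 0.
\<close>

fun shape :: "nat list \<Rightarrow> nat list" where
  "shape [] = []"
| "shape (b # bs) = (if bs = [] then [] else replicate b (sum_list bs) @ shape bs)"

lemma shape_bounds:
  assumes "0 \<notin> set bs" "x \<in> set (shape bs)"
  shows "1 \<le> x \<and> x < sum_list bs"
  using assms
proof (induction bs)
  case (Cons b bs)
  moreover have "sum_list bs > 0" if "bs \<noteq> []"
    using that Cons.prems(1) by (cases bs) auto
  ultimately show ?case by (auto split: if_splits)
qed simp

lemma sorted_shape: "0 \<notin> set bs \<Longrightarrow> sorted_wrt (\<ge>) (shape bs)"
proof (induction bs)
  case (Cons b bs)
  have "sorted_wrt (\<ge>) (replicate b x)" for x :: nat
    by (induction b) auto
  moreover have "y \<le> sum_list bs" if "y \<in> set (shape bs)" for y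
    using shape_bounds[of bs y] that Cons.prems by simp
  ultimately show ?case
    using Cons by (simp add: sorted_wrt_append)
qed simp

lemma sum_list_shape: "sum_list (shape bs) = pair_sum bs"
  by (induction bs) (auto simp: sum_list_replicate)

text \<open>
  Stacking \<open>b\<close> rows of length \<open>x\<close> on a partition with shorter rows adds the corner \<open>(x, b)\<close> and
  moves the other corners by \<open>b\<close>. As \<open>N - b = x\<close>, the antidiagonal of the remaining partition is
  determined by \<open>x\<close>, which gives the recursion that matches \<open>shape\<close>.
\<close>

lemma level_block:
  assumes "b > 0" "\<And>y. y \<in> set r \<Longrightarrow> y < x"
  shows "level N (replicate b x @ r) \<longleftrightarrow> N = x + b \<and> level x r"
proof -
  have less: "r ! j < x" if "j < length r" for j
    using assms(2) that by simp
  have corner: "corner (replicate b x @ r) i \<longleftrightarrow> i = b - 1 \<or> b \<le> i \<and> corner r (i - b)" for i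
    using assms(1) less[of 0] by (auto simp: corner_def nth_append Suc_diff_le)
  show ?thesis
  proof
    assume lev: "level N (replicate b x @ r)"
    have N: "N = x + b"
      using lev[unfolded level_def, rule_format, of "b - 1"] assms(1)
      by (simp add: corner nth_append)
    moreover have "level x r"
      unfolding level_def
    proof (intro allI impI)
      fix i assume "corner r i"
      then show "r ! i + Suc i = x"
        using lev[unfolded level_def, rule_format, of "b + i"] N
        by (simp add: corner nth_append)
    qed
    ultimately show "N = x + b \<and> level x r" ..
  next
    assume "N = x + b \<and> level x r"
    then show "level N (replicate b x @ r)"
      using assms(1) by (auto simp: level_def corner nth_append)
  qed
qed

lemma level_shape: "0 \<notin> set bs \<Longrightarrow> level (sum_list bs) (shape bs)"
proof (induction bs)
  case (Cons b bs)
  then show ?case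
    using level_block[of b "shape bs" "sum_list bs"] shape_bounds[of bs]
    by (auto simp: level_def corner_def)
qed (simp add: level_def corner_def)

text \<open>
  The induction reaches the empty partition, which is level for every \<open>N\<close>; there the remaining
  \<open>N\<close> becomes the last part.
\<close>

lemma level_imp_shape:
  assumes "sorted_wrt (\<ge>) r" "\<forall>x\<in>set r. 1 \<le> x" "level N r" "N \<ge> 1"
  shows "\<exists>bs. 0 \<notin> set bs \<and> bs \<noteq> [] \<and> sum_list bs = N \<and> shape bs = r"
  using assms
proof (induction r arbitrary: N rule: length_induct)
  case (1 r)
  show ?case
  proof (cases r)
    case Nil
    then show ?thesis using "1.prems" by (intro exI[of _ "[N]"]) simp
  next
    case (Cons x q)
    define b where "b = length (takeWhile (\<lambda>y. y = x) r)"
    define r' where "r' = dropWhile (\<lambda>y. y = x) r"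
    have "takeWhile (\<lambda>y. y = x) r = replicate b x"
      unfolding b_def by (intro replicate_eqI) (auto dest: set_takeWhileD)
    then have r: "r = replicate b x @ r'"
      unfolding r'_def by (metis takeWhile_dropWhile_id)
    have b: "b > 0" by (simp add: b_def Cons)
    have sorted': "sorted_wrt (\<ge>) r'"
      using "1.prems"(1) by (simp add: r sorted_wrt_append)
    have less: "y < x" if "y \<in> set r'" for y
    proof -
      have ne: "r' \<noteq> []" using that by auto
      then have "hd r' \<noteq> x" unfolding r'_def by (rule hd_dropWhile)
      moreover have "hd r' \<le> x"
        using "1.prems"(1) hd_in_set[OF ne] b by (auto simp: r sorted_wrt_append)
      moreover have "y \<le> hd r'"
        using sorted' that by (cases r') auto
      ultimately show ?thesis by simp
    qed
    have N: "N = x + b" "level x r'"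
      using "1.prems"(3) level_block[OF b less] by (simp_all add: r)
    have "x \<ge> 1" using "1.prems"(2) Cons by simp
    moreover have "length r' < length r" using b by (simp add: r)
    moreover have "\<forall>y\<in>set r'. 1 \<le> y" using "1.prems"(2) by (simp add: r)
    ultimately obtain bs where "0 \<notin> set bs" "bs \<noteq> []" "sum_list bs = x" "shape bs = r'"
      using "1.IH" sorted' N(2) by meson
    then show ?thesis
      using b N(1) r by (intro exI[of _ "b # bs"]) simp
  qed
qed

lemma shape_inject:
  assumes "shape bs = shape cs" "sum_list bs = sum_list cs" "0 \<notin> set bs" "0 \<notin> set cs"
  shows "bs = cs"
  using assms
proof (induction bs arbitrary: cs)
  case Nil
  then show ?case by (cases cs) auto
next
  case (Cons b bs)
  then obtain c cs' where cs: "cs = c # cs'" by (cases cs) auto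
  have pos: "b > 0" "c > 0" using Cons.prems cs by auto
  have empty: "shape (d # ds) = [] \<longleftrightarrow> ds = []" if "d > 0" for d ds
    using that by simp
  have hd: "hd (shape (d # ds)) = sum_list ds" if "d > 0" "ds \<noteq> []" for d ds
    using that by (simp add: hd_append)
  show ?case
  proof (cases "bs = []")
    case True
    then have "cs' = []"
      using Cons.prems(1) cs empty[OF pos(1)] empty[OF pos(2)] by metis
    with True Cons.prems(2) cs show ?thesis by simp
  next
    case False
    then have "cs' \<noteq> []"
      using Cons.prems(1) cs empty[OF pos(1)] empty[OF pos(2)] by metis
    then have sum: "sum_list bs = sum_list cs'"
      using Cons.prems(1) cs hd[OF pos(1) False] hd[OF pos(2)] by metis
    then have "b = c" using Cons.prems(2) cs by simp
    moreover have "shape bs = shape cs'"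
      using Cons.prems(1) False \<open>cs' \<noteq> []\<close> \<open>b = c\<close> sum by (simp add: cs)
    then have "bs = cs'"
      using Cons.IH sum Cons.prems(3,4) by (simp add: cs)
    ultimately show ?thesis by (simp add: cs)
  qed
qed

lemma bij_betw_shape:
  "bij_betw shape (admissible k) {r. is_partition r k \<and> gorenstein r}"
proof (rule bij_betwI')
  fix bs cs assume bs: "bs \<in> admissible k" and cs: "cs \<in> admissible k"
  have "sum_list bs = sum_list cs" if eq: "shape bs = shape cs"
  proof -
    have empty: "shape ds = [] \<longleftrightarrow> ds = [1]" if "ds \<in> admissible k" for ds
      using that by (cases ds) (auto simp: admissible_def)
    \<comment> \<open>For a nonempty shape the sum of the parts is read off from any of its corners.\<close>
    show ?thesis
    proof (cases "shape bs = []")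
      case True
      then show ?thesis using empty[OF bs] empty[OF cs] eq by simp
    next
      case False
      let ?i = "length (shape bs) - 1"
      have "corner (shape bs) ?i" using False by (simp add: corner_def)
      moreover have "level (sum_list bs) (shape bs)" "level (sum_list cs) (shape bs)"
        using level_shape[of bs] level_shape[of cs] bs cs eq by (auto simp: admissible_def)
      ultimately show ?thesis by (metis level_def)
    qed
  qed
  then show "shape bs = shape cs \<longleftrightarrow> bs = cs"
    using bs cs shape_inject by (auto simp: admissible_def)
next
  fix bs assume "bs \<in> admissible k"
  then have bs: "0 \<notin> set bs" "pair_sum bs = k" by (auto simp: admissible_def)
  have "\<forall>x\<in>set (shape bs). 1 \<le> x" using shape_bounds[OF bs(1)] by blast
  then show "shape bs \<in> {r. is_partition r k \<and> gorenstein r}"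
    using gorenstein_iff_level[OF sorted_shape[OF bs(1)]] level_shape[OF bs(1)]
      sorted_shape[OF bs(1)] bs(2)
    by (auto simp: is_partition_def sum_list_shape)
next
  fix r assume "r \<in> {r. is_partition r k \<and> gorenstein r}"
  then have r: "sorted_wrt (\<ge>) r" "\<forall>x\<in>set r. 1 \<le> x" "sum_list r = k" "gorenstein r"
    by (auto simp: is_partition_def)
  show "\<exists>bs\<in>admissible k. r = shape bs"
  proof (cases "r = []")
    case True
    then show ?thesis
      using r(3) by (intro bexI[of _ "[1]"]) (auto simp: admissible_def)
  next
    case False
    obtain N where N: "level N r" using r gorenstein_iff_level by blast
    have "corner r (length r - 1)" using False by (simp add: corner_def)
    then have "N \<ge> 1" using N by (auto simp: level_def)
    then obtain bs where bs: "0 \<notin> set bs" "bs \<noteq> []" "shape bs = r"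
      using level_imp_shape[OF r(1,2) N] by blast
    then have "2 \<le> length bs"
      using False by (cases bs; cases "tl bs") auto
    with bs r(3) sum_list_shape[of bs] show ?thesis
      by (intro bexI[of _ bs]) (auto simp: admissible_def)
  qed
qed

theorem theorem15:
  fixes k :: nat
  shows "card (indec_avoiders k {[1, 3, 2], [2, 1, 3]}) = card {r. is_partition r k \<and> gorenstein r}"
  using bij_betw_same_card[OF bij_betw_rev_layered[of k]] bij_betw_same_card[OF bij_betw_shape[of k]]
  by simp

end
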